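(* Let $n\ge 2$, $A\in GL(n,\mathbb{R})$, $v\in\mathbb{R}^n$, and suppose $f(x)=f_{A,v}(x)=Ax+v$ is an affine diffeomorphism of $\mathbb{R}^n$ with no fixed point. Let $g$ be a complete Riemannian metric on $\mathbb{R}^n$ for which $f$ is Anosov, with constants $C\ge 1$ and $\lambda\in(0,1)$. Then for every $0\neq w\in\ker(A-I)$ and every $x\in\mathbb{R}^n$ there exist $\sigma\in\{-1,1\}$ and $c=c(x,w)>0$ such that $$\|w\|_{g,f^{\sigma m}(x)}\ge c\,\lambda^{-m}$$ for all sufficiently large integers $m$.
   Context: A diffeomorphism $f$ of $\mathbb{R}^n$ is Anosov with respect to a Riemannian metric $g$, with constants $C\ge1$ and $\lambda\in(0,1)$, if there is a continuous $Df$-invariant splitting $T\mathbb{R}^n=E^s\oplus E^u$ (possibly trivial: $E^s=\{0\}$ or $E^u=\{0\}$ allowed) such that for all integers $m\ge 0$: $\|Df^m(u)\|_g\le C\lambda^m\|u\|_g$ for $u\in E^s$ and $\|Df^{-m}(u)\|_g\le C\lambda^m\|u\|_g$ for $u\in E^u$. For $w\in\mathbb{R}^n$ and $p\in\mathbb{R}^n$, $\|w\|_{g,p}$ is the $g$-norm of $w$ regarded as a vector of $T_p\mathbb{R}^n\cong\mathbb{R}^n$. *)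

theory Defs
  imports "HOL-Analysis.Analysis"
begin

text \<open>In finite dimension a map is of class C^(k+1) iff it is differentiable and all its
  directional derivatives are of class C^k.\<close>

primrec Ck :: "nat \<Rightarrow> ('a::euclidean_space \<Rightarrow> 'b::real_normed_vector) \<Rightarrow> bool" where
  "Ck 0 f \<longleftrightarrow> continuous_on UNIV f"
| "Ck (Suc k) f \<longleftrightarrow> f differentiable_on UNIV \<and> (\<forall>v. Ck k (\<lambda>p. frechet_derivative f (at p) v))"

definition smooth :: "('a::euclidean_space \<Rightarrow> 'b::real_normed_vector) \<Rightarrow> bool" where
  "smooth f \<longleftrightarrow> (\<forall>k. Ck k f)"

definition diffeomorphism :: "('a::euclidean_space \<Rightarrow> 'a) \<Rightarrow> bool" where
  "diffeomorphism f \<longleftrightarrow> bij f \<and> smooth f \<and> smooth (inv f)"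

definition iterate :: "('a \<Rightarrow> 'a) \<Rightarrow> int \<Rightarrow> 'a \<Rightarrow> 'a" where
  "iterate f k = (if k \<ge> 0 then f ^^ nat k else inv f ^^ nat (- k))"

text \<open>All tangent spaces are identified with the ambient vector space; \<open>g p u v\<close> is the inner
  product of \<open>u\<close> and \<open>v\<close> at the base point \<open>p\<close>.\<close>

definition riemannian_metric :: "('a::euclidean_space \<Rightarrow> 'a \<Rightarrow> 'a \<Rightarrow> real) \<Rightarrow> bool" where
  "riemannian_metric g \<longleftrightarrow>
     (\<forall>p. bilinear (g p)) \<and>
     (\<forall>p u v. g p u v = g p v u) \<and>
     (\<forall>p u. u \<noteq> 0 \<longrightarrow> g p u u > 0) \<and>
     (\<forall>u v. smooth (\<lambda>p. g p u v))"

definition gnorm :: "('a::euclidean_space \<Rightarrow> 'a \<Rightarrow> 'a \<Rightarrow> real) \<Rightarrow> 'a \<Rightarrow> 'a \<Rightarrow> real" where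
  "gnorm g p u = sqrt (g p u u)"

definition speed :: "('a::euclidean_space \<Rightarrow> 'a \<Rightarrow> 'a \<Rightarrow> real) \<Rightarrow> (real \<Rightarrow> 'a) \<Rightarrow> real \<Rightarrow> real" where
  "speed g \<gamma> t = gnorm g (\<gamma> t) (vector_derivative \<gamma> (at t))"

text \<open>The library's \<^const>\<open>valid_path\<close> does not bound the derivative near the finitely many
  exceptional parameters, so a valid path may have infinite length, for which \<^const>\<open>integral\<close>
  would return 0. The integrability condition excludes these paths.\<close>

definition riem_dist :: "('a::euclidean_space \<Rightarrow> 'a \<Rightarrow> 'a \<Rightarrow> real) \<Rightarrow> 'a \<Rightarrow> 'a \<Rightarrow> real" where
  "riem_dist g p q =
     (INF \<gamma> \<in> {\<gamma>. valid_path \<gamma> \<and> pathstart \<gamma> = p \<and> pathfinish \<gamma> = q \<and>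
                  speed g \<gamma> integrable_on {0..1}}.
        integral {0..1} (speed g \<gamma>))"

definition complete_riemannian_metric :: "('a::euclidean_space \<Rightarrow> 'a \<Rightarrow> 'a \<Rightarrow> real) \<Rightarrow> bool" where
  "complete_riemannian_metric g \<longleftrightarrow>
     riemannian_metric g \<and> Metric_space.mcomplete UNIV (riem_dist g)"

text \<open>A continuous subbundle of the tangent bundle: locally spanned by a continuous frame.
  The rank \<open>k\<close> may be 0.\<close>

definition continuous_subbundle :: "('a::euclidean_space \<Rightarrow> 'a set) \<Rightarrow> bool" where
  "continuous_subbundle E \<longleftrightarrow>
     (\<forall>p. \<exists>U k (X :: nat \<Rightarrow> 'a \<Rightarrow> 'a). open U \<and> p \<in> U \<and>
        (\<forall>i<k. continuous_on U (X i)) \<and>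
        (\<forall>q\<in>U. inj_on (\<lambda>i. X i q) {..<k} \<and>
                independent ((\<lambda>i. X i q) ` {..<k}) \<and>
                span ((\<lambda>i. X i q) ` {..<k}) = E q))"

definition continuous_splitting ::
    "('a::euclidean_space \<Rightarrow> 'a set) \<Rightarrow> ('a \<Rightarrow> 'a set) \<Rightarrow> bool" where
  "continuous_splitting Es Eu \<longleftrightarrow>
     continuous_subbundle Es \<and> continuous_subbundle Eu \<and>
     (\<forall>p. Es p \<inter> Eu p = {0} \<and> (\<forall>w. \<exists>a\<in>Es p. \<exists>b\<in>Eu p. w = a + b))"

definition invariant_subbundle :: "('a::euclidean_space \<Rightarrow> 'a) \<Rightarrow> ('a \<Rightarrow> 'a set) \<Rightarrow> bool" where
  "invariant_subbundle f E \<longleftrightarrow> (\<forall>p. frechet_derivative f (at p) ` E p = E (f p))"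

definition anosov ::
    "('a::euclidean_space \<Rightarrow> 'a) \<Rightarrow> ('a \<Rightarrow> 'a \<Rightarrow> 'a \<Rightarrow> real) \<Rightarrow> real \<Rightarrow> real \<Rightarrow> bool" where
  "anosov f g C lam \<longleftrightarrow>
     diffeomorphism f \<and> C \<ge> 1 \<and> 0 < lam \<and> lam < 1 \<and>
     (\<exists>Es Eu. continuous_splitting Es Eu \<and>
        invariant_subbundle f Es \<and> invariant_subbundle f Eu \<and>
        (\<forall>(m::nat) p. \<forall>u\<in>Es p.
           gnorm g ((f ^^ m) p) (frechet_derivative (f ^^ m) (at p) u) \<le> C * lam ^ m * gnorm g p u) \<and>
        (\<forall>(m::nat) p. \<forall>u\<in>Eu p.
           gnorm g ((inv f ^^ m) p) (frechet_derivative (inv f ^^ m) (at p) u)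
             \<le> C * lam ^ m * gnorm g p u))"

end

theory Submission
  imports Defs
begin

text \<open>Since \<open>D(f^m) = A^m\<close> fixes \<open>w\<close>, split \<open>w = a + b\<close> at \<open>x\<close> into its stable and unstable parts.
  If \<open>b \<noteq> 0\<close>, then \<open>A^m b\<close> is expanded along the forward orbit while \<open>A^m a\<close> is contracted, so
  \<open>w = A^m a + A^m b\<close> grows. If \<open>b = 0\<close>, then \<open>w\<close> is stable at \<open>x\<close> and grows along the
  backward orbit.\<close>

text \<open>The derivative is the same \<open>T\<close> at every point, so the chain rule gives a
  plain power instead of a product along the orbit.\<close>

lemma has_derivative_funpow_const:
  fixes f T :: "'a::real_normed_vector \<Rightarrow> 'a"
  assumes "\<And>x. (f has_derivative T) (at x)"
  shows "((f ^^ m) has_derivative (T ^^ m)) (at x)"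
proof (induction m)
  case 0
  show ?case by (simp add: id_def)
next
  case (Suc m)
  then show ?case
    using diff_chain_at[OF Suc assms] by (simp add: o_def)
qed

lemma funpow_image_invariant:
  assumes "\<And>p. T ` E p = E (f p)"
  shows "(T ^^ m) ` E p = E ((f ^^ m) p)"
proof (induction m)
  case (Suc m)
  then show ?case
    using assms[of "(f ^^ m) p"] by (simp add: image_image[symmetric])
qed simp

text \<open>A weak triangle inequality, from the parallelogram law; it makes the Cauchy-Schwarz
  inequality unnecessary.\<close>

lemma gnorm_diff_le_max:
  assumes "riemannian_metric g"
  shows "gnorm g p (u - v) \<le> 2 * max (gnorm g p u) (gnorm g p v)"
proof -
  have bil: "bilinear (g p)"
    using assms by (simp add: riemannian_metric_def)
  have nn: "g p z z \<ge> 0" for z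
    using assms bilinear_lzero[OF bil, of 0]
    by (cases "z = 0") (simp_all add: riemannian_metric_def less_imp_le)
  have "g p (u - v) (u - v) + g p (u + v) (u + v) = 2 * g p u u + 2 * g p v v"
    by (simp add: bilinear_lsub[OF bil] bilinear_rsub[OF bil]
        bilinear_ladd[OF bil] bilinear_radd[OF bil])
  then have "g p (u - v) (u - v) \<le> 2 * g p u u + 2 * g p v v"
    using nn[of "u + v"] by linarith
  also have "\<dots> \<le> 4 * max (g p u u) (g p v v)"
    by linarith
  finally have "gnorm g p (u - v) \<le> sqrt (4 * max (g p u u) (g p v v))"
    by (simp add: gnorm_def)
  also have "\<dots> = 2 * max (gnorm g p u) (gnorm g p v)"
    by (simp add: gnorm_def real_sqrt_mult max_def)
  finally show ?thesis .
qed

lemma gnorm_pos: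
  assumes "riemannian_metric g" "u \<noteq> 0"
  shows "gnorm g p u > 0"
  using assms by (simp add: gnorm_def riemannian_metric_def)

text \<open>Growth is proved for natural exponents; this carries it over to integers tending to
  infinity, which are eventually nonnegative.\<close>

lemma eventually_int_at_top_powiI:
  fixes lam :: real
  assumes "\<forall>\<^sub>F k in sequentially. c / lam ^ k \<le> F (int k)"
  shows "\<forall>\<^sub>F m :: int in at_top. F m \<ge> c * lam powi (- m)"
proof -
  obtain N where N: "\<And>k. k \<ge> N \<Longrightarrow> c / lam ^ k \<le> F (int k)"
    using assms by (auto simp: eventually_sequentially)
  show ?thesis
  proof (rule eventually_at_top_linorderI[of "int N"])
    fix m :: int
    assume m: "int N \<le> m"
    then obtain k where k: "m = int k"
      using zero_le_imp_eq_int[of m] by auto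
    with m show "c * lam powi (- m) \<le> F m"
      using N[of k] by (simp add: power_int_minus field_simps)
  qed
qed

theorem proposition4p3:
  fixes A :: "real ^ 'n ^ 'n" and v :: "real ^ 'n"
    and g :: "real ^ 'n \<Rightarrow> real ^ 'n \<Rightarrow> real ^ 'n \<Rightarrow> real"
    and f :: "real ^ 'n \<Rightarrow> real ^ 'n"
    and C lam :: real
  assumes "CARD('n) \<ge> 2"
    and "invertible A"
    and "f = (\<lambda>x. A *v x + v)"
    and "\<forall>x. f x \<noteq> x"
    and "complete_riemannian_metric g"
    and "C \<ge> 1" and "0 < lam" and "lam < 1"
    and "anosov f g C lam"
  shows "\<forall>w x. w \<noteq> 0 \<and> (A - mat 1) *v w = 0 \<longrightarrow>
           (\<exists>\<sigma>\<in>{-1, 1::int}. \<exists>c>0. \<forall>\<^sub>F m :: int in at_top.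
              gnorm g (iterate f (\<sigma> * m) x) w \<ge> c * lam powi (- m))"
proof (intro allI impI)
  fix w x :: "real ^ 'n"
  assume "w \<noteq> 0 \<and> (A - mat 1) *v w = 0"
  then have w: "w \<noteq> 0" and Aw: "A *v w = w"
    by (auto simp: matrix_vector_mult_diff_rdistrib)
  have g: "riemannian_metric g"
    using assms(5) by (simp add: complete_riemannian_metric_def)
  have C: "C > 0"
    using assms(6) by simp
  define T where "T = (*v) A"
  obtain B where B: "A ** B = mat 1" "B ** A = mat 1"
    using assms(2) by (auto simp: invertible_def)
  define S where "S = (*v) B"
  have ST: "S (T u) = u" and TS: "T (S u) = u" for u
    by (simp_all add: S_def T_def matrix_vector_mul_assoc B)
  have STm: "(S ^^ m) ((T ^^ m) u) = u" for m u
    by (induction m arbitrary: u) (simp_all add: ST funpow_swap1)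
  have linT: "linear T" and linS: "linear S"
    by (simp_all add: S_def T_def)
  have Tm_add: "(T ^^ m) (a + b) = (T ^^ m) a + (T ^^ m) b" for m a b
    by (induction m) (simp_all add: linear_add[OF linT])
  have Tw: "(T ^^ m) w = w" for m
    by (induction m) (simp_all add: T_def Aw)
  have Sw: "(S ^^ m) w = w" for m
    using STm[of m w] by (simp add: Tw)
  have f_eq: "f = (\<lambda>x. T x + v)"
    by (simp add: T_def assms(3))
  have invf: "inv f = (\<lambda>y. S (y - v))"
    by (rule inv_unique_comp) (auto simp: f_eq ST TS fun_eq_iff)
  have "bij f"
    using assms(9) by (simp add: anosov_def diffeomorphism_def)
  then have inv_f_funpow: "(inv f ^^ m) ((f ^^ m) p) = p"
    and f_inv_funpow: "(f ^^ m) ((inv f ^^ m) p) = p" for m p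
    by (induction m arbitrary: p)
      (simp_all add: funpow_swap1 bij_is_inj bij_is_surj surj_f_inv_f)
  have df: "(f has_derivative T) (at p)" for p
    unfolding f_eq by (auto intro!: derivative_eq_intros linear_imp_has_derivative linT)
  have "((\<lambda>y. S y - S v) has_derivative S) (at p)" for p
    by (auto intro!: derivative_eq_intros linear_imp_has_derivative linS)
  then have dinvf: "(inv f has_derivative S) (at p)" for p
    by (simp add: invf linear_diff[OF linS])
  \<comment> \<open>Uniqueness of the derivative turns the Anosov conditions into statements about
    powers of \<open>T\<close> and \<open>S\<close>, where the base point enters only through the
    norms and the bundles.\<close>
  have fd: "frechet_derivative f (at p) = T"
    and fdm: "frechet_derivative (f ^^ m) (at p) = T ^^ m"
    and fdinvm: "frechet_derivative (inv f ^^ m) (at p) = S ^^ m" for m p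
    using has_derivative_funpow_const[OF df] has_derivative_funpow_const[OF dinvf] df
    by (metis frechet_derivative_at)+
  obtain Es Eu where split: "continuous_splitting Es Eu"
    and inv_s: "\<And>p. T ` Es p = Es (f p)" and inv_u: "\<And>p. T ` Eu p = Eu (f p)"
    and stable: "\<And>m p u. u \<in> Es p \<Longrightarrow> gnorm g ((f ^^ m) p) ((T ^^ m) u) \<le> C * lam ^ m * gnorm g p u"
    and unstable: "\<And>m p u. u \<in> Eu p \<Longrightarrow>
        gnorm g ((inv f ^^ m) p) ((S ^^ m) u) \<le> C * lam ^ m * gnorm g p u"
    using assms(9) unfolding anosov_def invariant_subbundle_def fd fdm fdinvm
    by (elim conjE exE) (rule that, assumption, simp_all)
  obtain a b where a: "a \<in> Es x" and b: "b \<in> Eu x" and w_ab: "w = a + b"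
    using split unfolding continuous_splitting_def by blast
  show "\<exists>\<sigma>\<in>{-1, 1::int}. \<exists>c>0. \<forall>\<^sub>F m :: int in at_top.
          gnorm g (iterate f (\<sigma> * m) x) w \<ge> c * lam powi (- m)"
  proof (cases "b = 0")
    case True
    \<comment> \<open>Here \<open>w = a\<close> is stable at \<open>x\<close>. Contraction is
      applied at the backward point \<open>(inv f ^^ m) x\<close>: it carries \<open>w\<close> there
      to \<open>w\<close> at \<open>x\<close>.\<close>
    have "gnorm g x w / C / lam ^ m \<le> gnorm g ((inv f ^^ m) x) w" for m
    proof -
      have "w \<in> (T ^^ m) ` Es ((inv f ^^ m) x)"
        using funpow_image_invariant[of T Es f m "(inv f ^^ m) x", OF inv_s] a True
        by (simp add: w_ab f_inv_funpow)
      \<comment> \<open>A stable preimage \<open>u\<close> of \<open>w\<close> under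
        \<open>T ^^ m\<close> must be \<open>w\<close> itself, since
        \<open>u = (S ^^ m) w = w\<close>.\<close>
      then have "w \<in> Es ((inv f ^^ m) x)"
        using STm Sw by (metis imageE)
      from stable[OF this, of m] show ?thesis
        using C assms(7) by (simp add: f_inv_funpow Tw field_simps)
    qed
    \<comment> \<open>At \<open>m = 0\<close> the definition takes its forward branch, hence the
      case split.\<close>
    moreover have "iterate f (- 1 * int m) x = (inv f ^^ m) x" for m
      by (cases "m = 0") (auto simp: iterate_def)
    ultimately have "\<forall>\<^sub>F m :: int in at_top.
        gnorm g (iterate f (- 1 * m) x) w \<ge> gnorm g x w / C * lam powi (- m)"
      by (intro eventually_int_at_top_powiI always_eventually) simp
    moreover have "gnorm g x w / C > 0"
      using C w g by (simp add: gnorm_pos)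
    ultimately show ?thesis by blast
  next
    case False
    \<comment> \<open>Backward contraction at \<open>(f ^^ m) x\<close>, applied to
      \<open>(T ^^ m) b\<close>, returns to \<open>b\<close> at \<open>x\<close>; read in reverse,
      it is forward expansion.\<close>
    have grow: "gnorm g x b / C / lam ^ m \<le> gnorm g ((f ^^ m) x) ((T ^^ m) b)" for m
    proof -
      have "(T ^^ m) b \<in> Eu ((f ^^ m) x)"
        using funpow_image_invariant[of T Eu f m x, OF inv_u] b by blast
      from unstable[OF this, of m] show ?thesis
        using C assms(7) by (simp add: STm inv_f_funpow field_simps)
    qed
    have pos: "gnorm g x b / C > 0"
      using C False g by (simp add: gnorm_pos)
    \<comment> \<open>The stable part decays, so twice its norm eventually drops below a fixed
      positive number, itself at most the bound in \<open>grow\<close>. The factor 2 is that of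
      \<open>gnorm_diff_le_max\<close>.\<close>
    have "(\<lambda>m. 2 * (C * lam ^ m * gnorm g x a)) \<longlonglongrightarrow> 2 * (C * 0 * gnorm g x a)"
      by (intro tendsto_intros LIMSEQ_realpow_zero) (use assms(7,8) in auto)
    then have "\<forall>\<^sub>F m in sequentially. 2 * (C * lam ^ m * gnorm g x a) < gnorm g x b / C"
      using pos by (intro order_tendstoD(2)) auto
    then have "\<forall>\<^sub>F m in sequentially. gnorm g x b / C / 2 / lam ^ m \<le> gnorm g ((f ^^ m) x) w"
    proof eventually_elim
      case (elim m)
      let ?n = "gnorm g ((f ^^ m) x)"
      have "gnorm g x b / C \<le> gnorm g x b / C / lam ^ m"
        using divide_left_mono[of "lam ^ m" 1 "gnorm g x b / C"] pos assms(7,8)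
        by (simp add: power_le_one)
      then have "2 * ?n ((T ^^ m) a) < ?n ((T ^^ m) b)"
        using elim stable[OF a, of m] grow[of m] by linarith
      moreover have "(T ^^ m) b = w - (T ^^ m) a"
        using Tm_add[of m a b] Tw[of m] by (simp add: w_ab[symmetric] eq_diff_eq add.commute)
      then have "?n ((T ^^ m) b) \<le> 2 * max (?n w) (?n ((T ^^ m) a))"
        using gnorm_diff_le_max[OF g] by simp
      \<comment> \<open>The maximum cannot be the norm of \<open>(T ^^ m) a\<close>, as twice that
        is too small. So it is the norm of \<open>w\<close>, which is at least half that of
        \<open>(T ^^ m) b\<close>; hence the extra 2 in the constant.\<close>
      ultimately show ?case
        using grow[of m] by (simp add: max_def split: if_splits)
    qed
    then have "\<forall>\<^sub>F m :: int in at_top.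
        gnorm g (iterate f (1 * m) x) w \<ge> gnorm g x b / C / 2 * lam powi (- m)"
      by (intro eventually_int_at_top_powiI) (simp add: iterate_def)
    moreover have "gnorm g x b / C / 2 > 0"
      using pos by simp
    ultimately show ?thesis by blast
  qed
qed

end
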